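(* For alternating automata, both Boolean and quantitative, determinizability by pruning implies neither history determinism nor good for gameness. That is, there exists a Boolean alternating automaton that is determinizable by pruning but is neither history deterministic nor good for games, and there exist a value function $\mathsf{Val}$ and an alternating quantitative $\mathsf{Val}$ automaton that is determinizable by pruning but is neither history deterministic nor good for games.
   Context: **Games.** Let $\Sigma$ be a finite nonempty alphabet. An arena is $(V,E,V_E,V_A,L)$ with a (possibly infinite) set $V$ of positions partitioned into Eve's positions $V_E$ and Adam's positions $V_A$, an initial position, edges $E\subseteq V\times V$ and labels $L:E\to\Sigma\cup\{\varepsilon\}$. In infinite-duration games every position has an outgoing edge. A play is a maximal path from the initial position; its non-$\varepsilon$ labels form a word. An $f$ game is an arena with payoff function $f$ (with $f:\Sigma^*\to\mathbb{R}$ or $f:\Sigma^\omega\to\mathbb{R}$; plays are assumed to induce words in the domain of $f$); the payoff of a play is the $f$-value of its word. The value of an Eve strategy is the infimum of payoffs over plays agreeing with it, and the value of an Adam strategy is the supremum. The game is determined if (sup over Eve strategies of their values) $=$ (inf over Adam strategies of their values); this number is the value of the game. Only determined games are considered. **Automata.** An alternating quantitative automaton is $\mathcal{A}=(\Sigma,Q,\iota,\delta)$ with finite nonempty state set $Q$, initial state $\iota\in Q$, and $\delta:Q\times\Sigma\to \mathsf{B}^+(\mathbb{Q}\times Q)$, where $\mathsf{B}^+(\mathbb{Q}\times Q)$ is the set of positive Boolean formulas over (rational weight, state) pairs; it is total (each $\delta(q,a)$ contains at least one pair). It is deterministic if every $\delta(q,a)$ is a single pair. A $\mathsf{Val}$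 automaton is one equipped with a value function $\mathsf{Val}:\mathbb{Q}^*\to\mathbb{R}$ (finite words) or $\mathsf{Val}:\mathbb{Q}^\omega\to\mathbb{R}$ (infinite words). For a word $w$, the game $G(\mathcal{A},w)$ is played letter by letter from $\iota$: in state $q$ with next letter $a$, Eve resolves the disjunctions and Adam the conjunctions of $\delta(q,a)$ until a pair $(x,q')$ is reached; weight $x$ is output and the state becomes $q'$. The payoff is $\mathsf{Val}$ of the output weight sequence, and $\mathcal{A}(w)$ is the value of this game (assumed determined for all $w$). Equivalence $\mathcal{A}\equiv\mathcal{A}'$ means $\mathcal{A}(w)=\mathcal{A}'(w)$ for all $w$. Boolean automata (such as alternating finite automata on finite words with a set of accepting states) are treated in the same way with payoffs in $\{0,1\}$: a run has payoff $1$ if it is accepting (e.g. ends in an accepting state) and $0$ otherwise, and $\mathcal{A}(w)=1$ iff $w$ is accepted. **Product.** For a $\Sigma$-labelled game $G$ and an automaton $\mathcal{A}$ over $\Sigma$, the product game $G\times\mathcal{A}$ starts in (initial position of $G$, $\iota$). From $(v,q)$ the owner of $v$ in $G$ picks an edge $(v,v')$; if it is labelled $\varepsilon$ the game moves to $(v',q)$; if it is labelled $a\in\Sigma$, then Eve resolves the disjunctions and Adam the conjunctions of $\delta(q,a)$ until a pair $(x,q')$ is reached, weight $x$ is output, and the game moves to $(v',q')$. The payoff is $\mathsf{Val}$ of the output weight sequence (payoff of the run). **Good for games.** $\mathcal{A}$ realizing $f$ is good for games if for every determined game $G$ with a $\Sigma$-labelled arena and payoff function $f$, $G$ and $G\times\mathcal{A}$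 have the same value. **History determinism.** Eve's letter game on $\mathcal{A}$: starting from $\iota$, repeatedly, in state $q$ Adam picks a letter $a\in\Sigma$, then Eve resolves the disjunctions and Adam the conjunctions of $\delta(q,a)$, yielding a transition and a new state. An infinite play yields an infinite word $w$ and an infinite sequence $\pi$ of transitions. For infinite words, Eve wins the play if $\mathsf{Val}(\pi)\ge\mathcal{A}(w)$; for finite words, if $\mathsf{Val}(\pi[0..i])\ge\mathcal{A}(w[0..i])$ for all $i$. Adam's letter game is the same except that Eve picks the letters, and Adam wins the play if $\mathsf{Val}(\pi)\le\mathcal{A}(w)$ (for finite words: for all prefixes). $\mathcal{A}$ is history deterministic if Eve has a winning strategy in Eve's letter game and Adam has one in Adam's letter game. **Determinizability by pruning.** $\mathcal{A}$ is determinizable by pruning if there is a deterministic automaton (of the same type) equivalent to $\mathcal{A}$ derived from $\mathcal{A}$ by removing states and disjunctive and conjunctive choices (so that each remaining $\delta(q,a)$ becomes one of its atoms). *)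

theory Defs
  imports "HOL-Library.Extended_Real" "HOL-Library.Infinite_Set"
begin

section \<open>Finite and infinite sequences\<close>

datatype 'a seq = FinSeq "'a list" | InfSeq "nat \<Rightarrow> 'a"

fun has_idx :: "'a seq \<Rightarrow> nat \<Rightarrow> bool" where
  "has_idx (FinSeq xs) i \<longleftrightarrow> i < length xs"
| "has_idx (InfSeq f) i \<longleftrightarrow> True"

fun seq_nth :: "'a seq \<Rightarrow> nat \<Rightarrow> 'a" where
  "seq_nth (FinSeq xs) i = xs ! i"
| "seq_nth (InfSeq f) i = f i"

datatype word_kind = FiniteWords | InfiniteWords

definition words :: "word_kind \<Rightarrow> 'a set \<Rightarrow> 'a seq set" where
  "words k \<Sigma> = (case k of
      FiniteWords \<Rightarrow> {FinSeq u | u. set u \<subseteq> \<Sigma>}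
    | InfiniteWords \<Rightarrow> {InfSeq u | u. range u \<subseteq> \<Sigma>})"


section \<open>Games\<close>

datatype player = Eve | Adam

text \<open>The partition of the positions into Eve's and Adam's is given by \<open>owner\<close>. The label
  \<open>None\<close> stands for the empty word. Only labels of edges matter.\<close>

record ('v, 'l) arena =
  positions :: "'v set"
  owner :: "'v \<Rightarrow> player"
  start :: 'v
  edges :: "('v \<times> 'v) set"
  label :: "'v \<times> 'v \<Rightarrow> 'l option"

definition arena_over :: "'l set \<Rightarrow> ('v, 'l) arena \<Rightarrow> bool" where
  "arena_over \<Sigma> G \<longleftrightarrow>
     start G \<in> positions G \<and>
     edges G \<subseteq> positions G \<times> positions G \<and>
     (\<forall>e\<in>edges G. set_option (label G e) \<subseteq> \<Sigma>)"

text \<open>Plays are the maximal paths from the start position; they may be finite or infinite.\<close>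

definition plays :: "('v, 'l) arena \<Rightarrow> 'v seq set" where
  "plays G = {p. has_idx p 0 \<and> seq_nth p 0 = start G \<and>
     (\<forall>i. has_idx p (Suc i) \<longrightarrow> (seq_nth p i, seq_nth p (Suc i)) \<in> edges G) \<and>
     (\<forall>i. has_idx p i \<and> \<not> has_idx p (Suc i) \<longrightarrow> (\<forall>v. (seq_nth p i, v) \<notin> edges G))}"

text \<open>The word of a play: the sequence of its labels without the empty ones. It is finite
  also for an infinite play that has only finitely many nonempty labels.\<close>

definition trace :: "('v, 'l) arena \<Rightarrow> 'v seq \<Rightarrow> 'l seq" where
  "trace G p =
     (let lab = (\<lambda>i. label G (seq_nth p i, seq_nth p (Suc i)));
          I = {i. has_idx p (Suc i) \<and> lab i \<noteq> None}
      in if finite I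
         then FinSeq (map (\<lambda>i. the (lab i)) (sorted_list_of_set I))
         else InfSeq (\<lambda>n. the (lab (enumerate I n))))"

definition game_over :: "word_kind \<Rightarrow> 'l set \<Rightarrow> ('v, 'l) arena \<Rightarrow> bool" where
  "game_over k \<Sigma> G \<longleftrightarrow>
     arena_over \<Sigma> G \<and>
     (k = InfiniteWords \<longrightarrow> (\<forall>v\<in>positions G. \<exists>v'. (v, v') \<in> edges G)) \<and>
     (\<forall>p\<in>plays G. trace G p \<in> words k \<Sigma>)"

text \<open>A strategy maps the nonempty sequence of positions visited so far to the next position.\<close>

definition strategies :: "player \<Rightarrow> ('v, 'l) arena \<Rightarrow> ('v list \<Rightarrow> 'v) set" where
  "strategies P G = {\<sigma>. \<forall>h. h \<noteq> [] \<and> owner G (last h) = P \<and> (\<exists>v. (last h, v) \<in> edges G)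
     \<longrightarrow> (last h, \<sigma> h) \<in> edges G}"

definition outcomes :: "player \<Rightarrow> ('v, 'l) arena \<Rightarrow> ('v list \<Rightarrow> 'v) \<Rightarrow> 'v seq set" where
  "outcomes P G \<sigma> = {p \<in> plays G. \<forall>i. has_idx p (Suc i) \<and> owner G (seq_nth p i) = P
     \<longrightarrow> seq_nth p (Suc i) = \<sigma> (map (seq_nth p) [0..<Suc i])}"

definition lower_value :: "('v, 'l) arena \<Rightarrow> ('l seq \<Rightarrow> real) \<Rightarrow> ereal" where
  "lower_value G f =
     (SUP \<sigma>\<in>strategies Eve G. INF p\<in>outcomes Eve G \<sigma>. ereal (f (trace G p)))"

definition upper_value :: "('v, 'l) arena \<Rightarrow> ('l seq \<Rightarrow> real) \<Rightarrow> ereal" where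
  "upper_value G f =
     (INF \<tau>\<in>strategies Adam G. SUP p\<in>outcomes Adam G \<tau>. ereal (f (trace G p)))"

text \<open>The game with payoff \<open>f\<close> is determined, and its value is \<open>r\<close>.\<close>

definition has_value :: "('v, 'l) arena \<Rightarrow> ('l seq \<Rightarrow> real) \<Rightarrow> ereal \<Rightarrow> bool" where
  "has_value G f r \<longleftrightarrow> lower_value G f = r \<and> upper_value G f = r"


section \<open>Alternating automata\<close>

text \<open>There are no constants for true and false, so every formula contains an atom.\<close>

datatype (atoms: 'p) bform = Atom 'p | Disj "'p bform" "'p bform" | Conj "'p bform" "'p bform"

fun choices :: "'p bform \<Rightarrow> 'p bform set" where
  "choices (Atom p) = {}"
| "choices (Disj \<phi> \<psi>) = {\<phi>, \<psi>}"
| "choices (Conj \<phi> \<psi>) = {\<phi>, \<psi>}"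

fun subformulas :: "'p bform \<Rightarrow> 'p bform set" where
  "subformulas (Atom p) = {Atom p}"
| "subformulas (Disj \<phi> \<psi>) = insert (Disj \<phi> \<psi>) (subformulas \<phi> \<union> subformulas \<psi>)"
| "subformulas (Conj \<phi> \<psi>) = insert (Conj \<phi> \<psi>) (subformulas \<phi> \<union> subformulas \<psi>)"

text \<open>An atom leaves no choice, so its owner is irrelevant.\<close>

fun resolver :: "'p bform \<Rightarrow> player" where
  "resolver (Atom p) = Eve"
| "resolver (Disj \<phi> \<psi>) = Eve"
| "resolver (Conj \<phi> \<psi>) = Adam"

text \<open>Boolean and quantitative automata share this structure. The component \<open>run_value\<close> gives
  the payoff of a run, that is, of the sequence of the (weight, target state) pairs output along
  it. For quantitative automata it is a value function applied to the weights; for Boolean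
  automata, where \<open>'x\<close> is \<open>unit\<close>, it is 1 or 0 according to acceptance.\<close>

record ('a, 'x, 'q) automaton =
  kind :: word_kind
  alphabet :: "'a set"
  states :: "'q set"
  initial :: 'q
  delta :: "'q \<Rightarrow> 'a \<Rightarrow> ('x \<times> 'q) bform"
  run_value :: "('x \<times> 'q) seq \<Rightarrow> real"

definition delta_subformulas :: "('a, 'x, 'q) automaton \<Rightarrow> ('x \<times> 'q) bform set" where
  "delta_subformulas A = (\<Union>q\<in>states A. \<Union>a\<in>alphabet A. subformulas (delta A q a))"


subsection \<open>Product of a game and an automaton\<close>

text \<open>In \<open>Main v q\<close> an edge of the game is to be picked; in \<open>Resolve v \<phi>\<close> the formula \<open>\<phi>\<close> is
  being resolved, the game component having already moved to \<open>v\<close>.\<close>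

datatype ('v, 'x, 'q) product_pos = Main 'v 'q | Resolve 'v "('x \<times> 'q) bform"

fun product_owner :: "('v, 'l) arena \<Rightarrow> ('v, 'x, 'q) product_pos \<Rightarrow> player" where
  "product_owner G (Main v q) = owner G v"
| "product_owner G (Resolve v \<phi>) = resolver \<phi>"

fun product_label ::
  "('v, 'x, 'q) product_pos \<times> ('v, 'x, 'q) product_pos \<Rightarrow> ('x \<times> 'q) option" where
  "product_label (Resolve v (Atom p), Main v' q') = Some p"
| "product_label _ = None"

definition product ::
  "('v, 'a) arena \<Rightarrow> ('a, 'x, 'q) automaton \<Rightarrow> (('v, 'x, 'q) product_pos, 'x \<times> 'q) arena" where
  "product G A = \<lparr>
     positions = {Main v q | v q. v \<in> positions G \<and> q \<in> states A}
       \<union> {Resolve v \<phi> | v \<phi>. v \<in> positions G \<and> \<phi> \<in> delta_subformulas A},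
     owner = product_owner G,
     start = Main (start G) (initial A),
     edges = {(Main v q, Main v' q) | v v' q.
           (v, v') \<in> edges G \<and> label G (v, v') = None \<and> q \<in> states A}
       \<union> {(Main v q, Resolve v' (delta A q a)) | v v' q a.
           (v, v') \<in> edges G \<and> label G (v, v') = Some a \<and> q \<in> states A}
       \<union> {(Resolve v \<phi>, Resolve v \<psi>) | v \<phi> \<psi>.
           v \<in> positions G \<and> \<phi> \<in> delta_subformulas A \<and> \<psi> \<in> choices \<phi>}
       \<union> {(Resolve v (Atom (x, q)), Main v q) | v x q.
           v \<in> positions G \<and> Atom (x, q) \<in> delta_subformulas A},
     label = product_label \<rparr>"


subsection \<open>The function realized by an automaton\<close>

text \<open>The arena in which the only play spells the word \<open>w\<close>. Its product with an automaton \<open>A\<close> is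
  the game of \<open>A\<close> on \<open>w\<close>.\<close>

definition word_arena :: "'a seq \<Rightarrow> (nat, 'a) arena" where
  "word_arena w = \<lparr>
     positions = {i. \<forall>j<i. has_idx w j},
     owner = (\<lambda>_. Eve),
     start = 0,
     edges = {(i, Suc i) | i. has_idx w i},
     label = (\<lambda>(i, _). Some (seq_nth w i)) \<rparr>"

definition word_game ::
  "('a, 'x, 'q) automaton \<Rightarrow> 'a seq \<Rightarrow> ((nat, 'x, 'q) product_pos, 'x \<times> 'q) arena" where
  "word_game A w = product (word_arena w) A"

definition aut_val :: "('a, 'x, 'q) automaton \<Rightarrow> 'a seq \<Rightarrow> real" where
  "aut_val A w = (THE r. has_value (word_game A w) (run_value A) (ereal r))"

text \<open>The last conjunct: all word games are determined, with values in the reals.\<close>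

definition alternating_automaton :: "('a, 'x, 'q) automaton \<Rightarrow> bool" where
  "alternating_automaton A \<longleftrightarrow>
     finite (alphabet A) \<and> alphabet A \<noteq> {} \<and>
     finite (states A) \<and> initial A \<in> states A \<and>
     (\<forall>q\<in>states A. \<forall>a\<in>alphabet A. snd ` atoms (delta A q a) \<subseteq> states A) \<and>
     (\<forall>w\<in>words (kind A) (alphabet A).
        \<exists>r. has_value (word_game A w) (run_value A) (ereal r))"

definition equivalent :: "('a, 'x, 'q) automaton \<Rightarrow> ('a, 'x, 'q) automaton \<Rightarrow> bool" where
  "equivalent A B \<longleftrightarrow> kind A = kind B \<and> alphabet A = alphabet B \<and>
     (\<forall>w\<in>words (kind A) (alphabet A). aut_val A w = aut_val B w)"

definition quantitative_automaton ::
  "(rat seq \<Rightarrow> real) \<Rightarrow> ('a, rat, 'q) automaton \<Rightarrow> bool" where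
  "quantitative_automaton Val A \<longleftrightarrow> alternating_automaton A \<and>
     run_value A = (\<lambda>\<rho>. Val (map_seq fst \<rho>))"

text \<open>Acceptance of a finite run by its last state, which for the empty run is the initial one.
  The value on infinite runs is never used.\<close>

fun acceptance_value :: "'q \<Rightarrow> 'q set \<Rightarrow> ('x \<times> 'q) seq \<Rightarrow> real" where
  "acceptance_value q0 F (FinSeq \<rho>) = of_bool (last (q0 # map snd \<rho>) \<in> F)"
| "acceptance_value q0 F (InfSeq \<rho>) = 0"

definition alternating_finite_automaton ::
  "'q set \<Rightarrow> ('a, unit, 'q) automaton \<Rightarrow> bool" where
  "alternating_finite_automaton F A \<longleftrightarrow> alternating_automaton A \<and>
     kind A = FiniteWords \<and> F \<subseteq> states A \<and>
     run_value A = acceptance_value (initial A) F"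


section \<open>Determinizability by pruning\<close>

definition deterministic :: "('a, 'x, 'q) automaton \<Rightarrow> bool" where
  "deterministic A \<longleftrightarrow> (\<forall>q\<in>states A. \<forall>a\<in>alphabet A. \<exists>p. delta A q a = Atom p)"

text \<open>\<open>B\<close> arises from \<open>A\<close> by removing states and resolving every formula to one of its atoms.
  The value function (or acceptance condition) is kept; on runs of \<open>B\<close>, keeping a set \<open>F\<close> of
  accepting states is the same as restricting it to the states of \<open>B\<close>.\<close>

definition pruned_to :: "('a, 'x, 'q) automaton \<Rightarrow> ('a, 'x, 'q) automaton \<Rightarrow> bool" where
  "pruned_to A B \<longleftrightarrow>
     kind B = kind A \<and> alphabet B = alphabet A \<and> initial B = initial A \<and>
     run_value B = run_value A \<and> states B \<subseteq> states A \<and>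
     (\<forall>q\<in>states B. \<forall>a\<in>alphabet B. \<exists>p\<in>atoms (delta A q a). delta B q a = Atom p)"

definition determinizable_by_pruning :: "('a, 'x, 'q) automaton \<Rightarrow> bool" where
  "determinizable_by_pruning A \<longleftrightarrow>
     (\<exists>B. alternating_automaton B \<and> deterministic B \<and> pruned_to A B \<and> equivalent A B)"


section \<open>Good for gameness\<close>

text \<open>A type of positions has to be fixed, and it bounds the cardinality of the arenas considered.
  Failure for some type of positions means failure for arbitrary arenas; conversely, the smaller
  the type, the stronger the claim of failure.\<close>

definition good_for_games :: "'v itself \<Rightarrow> ('a, 'x, 'q) automaton \<Rightarrow> bool" where
  "good_for_games _ A \<longleftrightarrow>
     (\<forall>G :: ('v, 'a) arena. \<forall>r. game_over (kind A) (alphabet A) G \<and> has_value G (aut_val A) r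
        \<longrightarrow> has_value (product G A) (run_value A) r)"


section \<open>History determinism\<close>

text \<open>The letter is recorded while its formula is resolved, and each edge leaving an atom outputs
  the letter together with the transition.\<close>

datatype ('a, 'x, 'q) letter_pos = PickLetter 'q | ResolveLetter 'a "('x \<times> 'q) bform"

fun letter_owner :: "player \<Rightarrow> ('a, 'x, 'q) letter_pos \<Rightarrow> player" where
  "letter_owner P (PickLetter q) = P"
| "letter_owner P (ResolveLetter a \<phi>) = resolver \<phi>"

fun letter_label ::
  "('a, 'x, 'q) letter_pos \<times> ('a, 'x, 'q) letter_pos \<Rightarrow> ('a \<times> ('x \<times> 'q)) option" where
  "letter_label (ResolveLetter a (Atom p), PickLetter q) = Some (a, p)"
| "letter_label _ = None"

text \<open>\<open>P\<close> is the player who picks the letters.\<close>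

definition letter_arena ::
  "player \<Rightarrow> ('a, 'x, 'q) automaton \<Rightarrow> (('a, 'x, 'q) letter_pos, 'a \<times> ('x \<times> 'q)) arena" where
  "letter_arena P A = \<lparr>
     positions = {PickLetter q | q. q \<in> states A}
       \<union> {ResolveLetter a \<phi> | a \<phi>. a \<in> alphabet A \<and> \<phi> \<in> delta_subformulas A},
     owner = letter_owner P,
     start = PickLetter (initial A),
     edges = {(PickLetter q, ResolveLetter a (delta A q a)) | q a.
           q \<in> states A \<and> a \<in> alphabet A}
       \<union> {(ResolveLetter a \<phi>, ResolveLetter a \<psi>) | a \<phi> \<psi>.
           a \<in> alphabet A \<and> \<phi> \<in> delta_subformulas A \<and> \<psi> \<in> choices \<phi>}
       \<union> {(ResolveLetter a (Atom (x, q)), PickLetter q) | a x q.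
           a \<in> alphabet A \<and> Atom (x, q) \<in> delta_subformulas A},
     label = letter_label \<rparr>"

text \<open>\<open>R\<close> compares the payoff of the run with the value of the word, at the end for infinite
  words and after every letter for finite words.\<close>

definition letter_objective ::
  "(real \<Rightarrow> real \<Rightarrow> bool) \<Rightarrow> ('a, 'x, 'q) automaton \<Rightarrow> ('a \<times> ('x \<times> 'q)) seq set" where
  "letter_objective R A = (case kind A of
      FiniteWords \<Rightarrow> {InfSeq \<pi> | \<pi>. \<forall>i.
        R (run_value A (FinSeq (map (\<lambda>j. snd (\<pi> j)) [0..<Suc i])))
          (aut_val A (FinSeq (map (\<lambda>j. fst (\<pi> j)) [0..<Suc i])))}
    | InfiniteWords \<Rightarrow> {InfSeq \<pi> | \<pi>.
        R (run_value A (InfSeq (\<lambda>j. snd (\<pi> j)))) (aut_val A (InfSeq (\<lambda>j. fst (\<pi> j))))})"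

definition wins :: "player \<Rightarrow> ('v, 'l) arena \<Rightarrow> 'l seq set \<Rightarrow> bool" where
  "wins P G W \<longleftrightarrow> (\<exists>\<sigma>\<in>strategies P G. \<forall>p\<in>outcomes P G \<sigma>. trace G p \<in> W)"

definition history_deterministic :: "('a, 'x, 'q) automaton \<Rightarrow> bool" where
  "history_deterministic A \<longleftrightarrow>
     wins Eve (letter_arena Adam A) (letter_objective (\<ge>) A) \<and>
     wins Adam (letter_arena Eve A) (letter_objective (\<le>) A)"

end

theory Submission
  imports Defs
begin

text \<open>Every word is accepted by an automaton that first lets Adam choose between an accepting sink
  and a branch in which Eve guesses the next letter. On a given word Eve guesses right, so pruning
  Adam's choice to the sink preserves the language. But when the letters are revealed one at a time
  by Adam, he refutes every guess.\<close>

section \<open>Strategies and values\<close>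

lemma strategy_move:
  assumes "\<sigma> \<in> strategies P G" "h \<noteq> []" "owner G (last h) = P" "(last h, v) \<in> edges G"
  shows "(last h, \<sigma> h) \<in> edges G"
  using assms unfolding strategies_def by blast

text \<open>An infimum over an empty set of outcomes would be infinite; a common outcome rules this
  out and compares the two players. Both strategies are unrolled in parallel, and the result is cut
  at its first dead end if there is one.\<close>

lemma joint_outcome:
  assumes \<sigma>: "\<sigma> \<in> strategies Eve G" and \<tau>: "\<tau> \<in> strategies Adam G"
  obtains p where "p \<in> outcomes Eve G \<sigma>" "p \<in> outcomes Adam G \<tau>"
proof -
  define step where "step h = (if owner G (last h) = Eve then \<sigma> h else \<tau> h)" for h
  \<comment> \<open>Strategies read the whole history, so the iteration carries it along, and
    \<open>f\<close> is recovered as its last position.\<close>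
  define hist where "hist n = ((\<lambda>h. h @ [step h]) ^^ n) [start G]" for n
  define f where "f n = last (hist n)" for n
  have hist_Suc: "hist (Suc n) = hist n @ [f (Suc n)]" and f_Suc: "f (Suc n) = step (hist n)" for n
    by (simp_all add: hist_def f_def)
  have hist: "hist n = map f [0..<Suc n]" for n
  proof (induction n)
    case 0
    show ?case
      by (simp add: hist_def f_def)
  next
    case (Suc n)
    show ?case
      unfolding hist_Suc Suc.IH by simp
  qed
  have f0: "f 0 = start G"
    by (simp add: f_def hist_def)
  have fSuc: "f (Suc n) = step (map f [0..<Suc n])" for n
    by (simp only: f_Suc hist)
  have follow: "f (Suc n) = \<sigma> (map f [0..<Suc n])" if "owner G (f n) = Eve" for n
    using that by (simp add: fSuc step_def)
  have follow': "f (Suc n) = \<tau> (map f [0..<Suc n])" if "owner G (f n) = Adam" for n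
    using that by (simp add: fSuc step_def)
  have move: "(f n, f (Suc n)) \<in> edges G" if "(f n, v) \<in> edges G" for n v
  proof (cases "owner G (f n)")
    case Eve
    then show ?thesis
      using strategy_move[OF \<sigma>, of "map f [0..<Suc n]" v] that unfolding follow[OF Eve] by simp
  next
    case Adam
    then show ?thesis
      using strategy_move[OF \<tau>, of "map f [0..<Suc n]" v] that unfolding follow'[OF Adam] by simp
  qed
  show ?thesis
  proof (cases "\<exists>n. \<forall>v. (f n, v) \<notin> edges G")
    case True
    \<comment> \<open>Beyond a dead end the strategies may return anything; only the part of
      \<open>f\<close> up to the first one is sure to be a path.\<close>
    define N where "N = (LEAST n. \<forall>v. (f n, v) \<notin> edges G)"
    have N: "\<forall>v. (f N, v) \<notin> edges G"
      unfolding N_def using True by (rule LeastI_ex)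
    have below: "(f i, f (Suc i)) \<in> edges G" if "i < N" for i
      using not_less_Least[OF that[unfolded N_def]] move by blast
    define p where "p = FinSeq (map f [0..<Suc N])"
    have nth: "seq_nth p i = f i" if "i \<le> N" for i
      using that by (simp add: p_def del: upt_Suc)
    have idx: "has_idx p i \<longleftrightarrow> i \<le> N" for i
      by (auto simp: p_def)
    have prefix: "map (seq_nth p) [0..<Suc i] = map f [0..<Suc i]" if "i \<le> N" for i
      using that nth by (intro map_cong) auto
    have "i = N" if "i \<le> N" "\<not> Suc i \<le> N" for i
      using that by simp
    then have play: "p \<in> plays G"
      unfolding plays_def mem_Collect_eq idx
      using N below nth f0 by (metis Suc_le_eq Suc_leD le0)
    have "p \<in> outcomes Eve G \<sigma>" "p \<in> outcomes Adam G \<tau>"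
      unfolding outcomes_def mem_Collect_eq idx
      using play follow follow' by (auto simp: nth prefix Suc_leD simp del: upt_Suc)
    then show ?thesis
      by (rule that)
  next
    case False
    then have "(f i, f (Suc i)) \<in> edges G" for i
      using move by blast
    then have "InfSeq f \<in> plays G"
      using f0 by (simp add: plays_def)
    moreover have "seq_nth (InfSeq f) = f"
      by (simp add: fun_eq_iff)
    ultimately have "InfSeq f \<in> outcomes Eve G \<sigma>" "InfSeq f \<in> outcomes Adam G \<tau>"
      using follow follow' by (simp_all add: outcomes_def del: upt_Suc)
    then show ?thesis
      by (rule that)
  qed
qed

text \<open>The positional strategy \<open>s\<close> moves into \<open>I\<close> whenever it can.
  Its second branch keeps it legal where no successor lies in \<open>I\<close>, because
  \<open>strategies\<close> constrains the answer on every history.\<close>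

lemma invariant_strategy:
  assumes start: "start G \<in> I"
    and own: "\<And>x y. x \<in> I \<Longrightarrow> owner G x = P \<Longrightarrow> (x, y) \<in> edges G \<Longrightarrow> \<exists>z\<in>I. (x, z) \<in> edges G"
    and other: "\<And>x y. x \<in> I \<Longrightarrow> owner G x \<noteq> P \<Longrightarrow> (x, y) \<in> edges G \<Longrightarrow> y \<in> I"
  obtains \<sigma> where "\<sigma> \<in> strategies P G"
    "\<And>p i. p \<in> outcomes P G \<sigma> \<Longrightarrow> has_idx p i \<Longrightarrow> seq_nth p i \<in> I"
proof
  define s where "s x = (if \<exists>z\<in>I. (x, z) \<in> edges G then SOME z. z \<in> I \<and> (x, z) \<in> edges G
      else SOME z. (x, z) \<in> edges G)" for x
  have s_edge: "(x, s x) \<in> edges G" if "(x, y) \<in> edges G" for x y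
  proof (cases "\<exists>z\<in>I. (x, z) \<in> edges G")
    case True
    then have "\<exists>z. z \<in> I \<and> (x, z) \<in> edges G"
      by blast
    from someI_ex[OF this] True show ?thesis
      by (simp add: s_def)
  next
    case False
    with someI[of "\<lambda>z. (x, z) \<in> edges G", OF that] show ?thesis
      by (simp add: s_def)
  qed
  have s_inv: "s x \<in> I" if "z \<in> I" "(x, z) \<in> edges G" for x z
  proof -
    have "\<exists>z. z \<in> I \<and> (x, z) \<in> edges G"
      using that by blast
    from someI_ex[OF this] that show ?thesis
      by (auto simp: s_def)
  qed
  show "(\<lambda>h. s (last h)) \<in> strategies P G"
    using s_edge by (auto simp: strategies_def)
  fix p i
  assume p: "p \<in> outcomes P G (\<lambda>h. s (last h))"
  show "has_idx p i \<Longrightarrow> seq_nth p i \<in> I"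
  proof (induction i)
    case 0
    then show ?case
      using p start by (simp add: outcomes_def plays_def)
  next
    case (Suc i)
    have "has_idx p i"
      using Suc.prems by (cases p) auto
    then have i: "seq_nth p i \<in> I"
      by (rule Suc.IH)
    have e: "(seq_nth p i, seq_nth p (Suc i)) \<in> edges G"
      using p Suc.prems by (simp add: outcomes_def plays_def)
    show ?case
    proof (cases "owner G (seq_nth p i) = P")
      case True
      then have "seq_nth p (Suc i) = s (seq_nth p i)"
        using p Suc.prems by (simp add: outcomes_def)
      with own[OF i True e] s_inv show ?thesis
        by auto
    next
      case False
      with other[OF i _ e] show ?thesis
        by blast
    qed
  qed
qed

lemma strategies_nonempty:
  obtains \<sigma> where "\<sigma> \<in> strategies P G"
proof (rule invariant_strategy)
  show "start G \<in> UNIV"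
    by simp
qed blast+

lemma outcome_play: "p \<in> outcomes P G \<sigma> \<Longrightarrow> p \<in> plays G"
  by (simp add: outcomes_def)

text \<open>Determinacy comes directly: \<open>\<sigma>\<close> secures \<open>c\<close> against
  every Adam strategy, and since no play exceeds \<open>c\<close>, an arbitrary Adam strategy
  already gives the upper bound.\<close>

lemma has_value_maximum:
  assumes \<sigma>: "\<sigma> \<in> strategies Eve G"
    and attained: "\<And>p. p \<in> outcomes Eve G \<sigma> \<Longrightarrow> f (trace G p) = c"
    and bounded: "\<And>p. p \<in> plays G \<Longrightarrow> f (trace G p) \<le> c"
  shows "has_value G f (ereal c)"
  unfolding has_value_def
proof
  obtain \<tau> where \<tau>: "\<tau> \<in> strategies Adam G"
    by (rule strategies_nonempty)
  show "lower_value G f = ereal c"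
    unfolding lower_value_def
  proof (rule antisym)
    show "(SUP \<sigma>\<in>strategies Eve G. INF p\<in>outcomes Eve G \<sigma>. ereal (f (trace G p))) \<le> ereal c"
    proof (rule SUP_least)
      fix \<sigma>'
      assume "\<sigma>' \<in> strategies Eve G"
      from joint_outcome[OF this \<tau>] obtain p where "p \<in> outcomes Eve G \<sigma>'"
        by blast
      then show "(INF p\<in>outcomes Eve G \<sigma>'. ereal (f (trace G p))) \<le> ereal c"
        using bounded outcome_play[of _ _ G] by (intro INF_lower2[of p]) auto
    qed
    show "ereal c \<le> (SUP \<sigma>\<in>strategies Eve G. INF p\<in>outcomes Eve G \<sigma>. ereal (f (trace G p)))"
      using \<sigma> attained by (intro SUP_upper2[of \<sigma>] INF_greatest) auto
  qed
  show "upper_value G f = ereal c"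
    unfolding upper_value_def
  proof (rule antisym)
    show "(INF \<tau>\<in>strategies Adam G. SUP p\<in>outcomes Adam G \<tau>. ereal (f (trace G p))) \<le> ereal c"
      using \<tau> bounded outcome_play[of _ _ G] by (intro INF_lower2[of \<tau>] SUP_least) auto
    show "ereal c \<le> (INF \<tau>\<in>strategies Adam G. SUP p\<in>outcomes Adam G \<tau>. ereal (f (trace G p)))"
    proof (rule INF_greatest)
      fix \<tau>'
      assume "\<tau>' \<in> strategies Adam G"
      from joint_outcome[OF \<sigma> this] obtain p
        where "p \<in> outcomes Eve G \<sigma>" "p \<in> outcomes Adam G \<tau>'"
        by blast
      then show "ereal c \<le> (SUP p\<in>outcomes Adam G \<tau>'. ereal (f (trace G p)))"
        using attained by (intro SUP_upper2[of p]) auto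
    qed
  qed
qed

lemma upper_value_le:
  assumes "\<tau> \<in> strategies Adam G"
    and "\<And>p. p \<in> outcomes Adam G \<tau> \<Longrightarrow> f (trace G p) \<le> c"
  shows "upper_value G f \<le> ereal c"
  unfolding upper_value_def using assms by (intro INF_lower2[of \<tau>] SUP_least) auto

lemma aut_val_eq:
  assumes "has_value (word_game A w) (run_value A) (ereal c)"
  shows "aut_val A w = c"
  unfolding aut_val_def using assms by (auto simp: has_value_def)

section \<open>Games without infinite plays\<close>

lemma finite_play:
  assumes "wf ((edges G)\<inverse>)" "p \<in> plays G"
  obtains xs where "p = FinSeq xs"
proof (cases p)
  case (InfSeq f)
  then have "(f (Suc i), f i) \<in> (edges G)\<inverse>" for i
    using assms(2) by (simp add: plays_def)
  then show ?thesis
    using assms(1) unfolding wf_iff_no_infinite_down_chain by blast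
qed

text \<open>The list form replaces the sorted set of labelled indices, so that outputs can be
  located by list reasoning.\<close>

lemma trace_FinSeq:
  "trace G (FinSeq xs) = FinSeq (map the (filter (\<lambda>l. l \<noteq> None) (map (label G) (zip xs (tl xs)))))"
proof -
  let ?lab = "\<lambda>i. label G (xs ! i, xs ! Suc i)"
  let ?I = "{i. Suc i < length xs \<and> ?lab i \<noteq> None}"
  have I: "?I = set (filter (\<lambda>i. ?lab i \<noteq> None) [0..<length xs - 1])"
    by auto
  have sorted: "sorted_list_of_set ?I = filter (\<lambda>i. ?lab i \<noteq> None) [0..<length xs - 1]"
    unfolding I by (intro sorted_list_of_set.idem_if_sorted_distinct) (auto intro: sorted_wrt_filter)
  have zip: "map (label G) (zip xs (tl xs)) = map ?lab [0..<length xs - 1]"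
    by (rule nth_equalityI) (auto simp: nth_tl)
  have "finite ?I"
    unfolding I by (rule finite_set)
  then show ?thesis
    unfolding zip
    by (simp only: trace_def Let_def has_idx.simps seq_nth.simps sorted if_True filter_map map_map comp_def)
qed

text \<open>Serves payoffs that depend only on the last output.\<close>

lemma trace_FinSeq_last:
  assumes "label G (x, y) = Some l"
  obtains ls where "trace G (FinSeq (xs @ [x, y])) = FinSeq (ls @ [l])"
proof -
  have "zip (xs @ [x, y]) (tl (xs @ [x, y])) = zip (xs @ [x]) (tl (xs @ [x])) @ [(x, y)]"
  proof (induction xs)
    case (Cons a xs)
    then show ?case
      by (cases xs) auto
  qed simp
  then show ?thesis
    using that assms by (simp add: trace_FinSeq)
qed

lemma trace_FinSeq_label:
  assumes "FinSeq xs \<in> plays G" and "trace G (FinSeq xs) = FinSeq ls" and "l \<in> set ls"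
  obtains x y where "x \<in> set xs" "(x, y) \<in> edges G" "label G (x, y) = Some l"
proof -
  obtain x y where xy: "(x, y) \<in> set (zip xs (tl xs))" "label G (x, y) = Some l"
    using assms(2,3) by (auto simp: trace_FinSeq)
  then obtain i where i: "Suc i < length xs" "x = xs ! i" "y = xs ! Suc i"
    unfolding in_set_zip by (metis fst_conv length_tl less_diff_conv nth_tl plus_1_eq_Suc snd_conv add.commute)
  then have "(x, y) \<in> edges G"
    using assms(1) by (simp add: plays_def)
  with i xy(2) show ?thesis
    by (intro that[of x y]) auto
qed

lemma game_over_FiniteWords:
  assumes "arena_over \<Sigma> G" "wf ((edges G)\<inverse>)"
  shows "game_over FiniteWords \<Sigma> G"
proof -
  have "trace G p \<in> words FiniteWords \<Sigma>" if p: "p \<in> plays G" for p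
  proof -
    obtain xs where xs: "p = FinSeq xs"
      using finite_play[OF assms(2) p] .
    obtain ls where ls: "trace G p = FinSeq ls"
      unfolding xs trace_FinSeq by blast
    have "l \<in> \<Sigma>" if l: "l \<in> set ls" for l
    proof -
      obtain x y where "(x, y) \<in> edges G" "label G (x, y) = Some l"
        using trace_FinSeq_label p ls l unfolding xs by metis
      then show ?thesis
        using assms(1) by (force simp: arena_over_def)
    qed
    then show ?thesis
      using ls by (auto simp: words_def)
  qed
  with assms(1) show ?thesis
    by (simp add: game_over_def)
qed

lemma size_choices: "\<psi> \<in> choices \<phi> \<Longrightarrow> size \<psi> < size \<phi>"
  by (cases \<phi>) auto

text \<open>Each move either advances the game component along an edge of \<open>G\<close> or keeps
  it and continues resolving a formula, which gets smaller.\<close>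

lemma wf_product:
  assumes "wf ((edges G)\<inverse>)"
  shows "wf ((edges (product G A))\<inverse>)"
proof (rule wf_subset)
  \<comment> \<open>An atom has size 0, so \<open>Suc\<close> is what makes the move from an atom to
    \<open>Main\<close> a descent.\<close>
  let ?m = "\<lambda>x. case x of Main v q \<Rightarrow> (v, 0) | Resolve v \<phi> \<Rightarrow> (v, Suc (size \<phi>))"
  show "wf (inv_image ((edges G)\<inverse> <*lex*> less_than) ?m)"
    using assms by (intro wf_inv_image wf_lex_prod wf_less_than)
  show "(edges (product G A))\<inverse> \<subseteq> inv_image ((edges G)\<inverse> <*lex*> less_than) ?m"
    by (auto simp: product_def size_choices)
qed

lemma wf_word_arena: "wf ((edges (word_arena (FinSeq u)))\<inverse>)"
  by (rule wf_subset[OF wf_measure[of "\<lambda>i. length u - i"]]) (auto simp: word_arena_def)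

section \<open>Guessing the next letter\<close>

text \<open>State 0 is initial, 1 is the accepting and 4 the rejecting sink, and in state \<open>a + 2\<close> the
  guess is that \<open>a\<close> is the next letter. The weight of a transition depends only on its target, so
  that acceptance by final states and by the last weight are instances of the same locale.\<close>

locale letter_guessing =
  fixes wt :: "nat \<Rightarrow> 'x" and val :: "('x \<times> nat) seq \<Rightarrow> real"
  assumes val_empty: "val (FinSeq []) = 1"
    and val_snoc: "q \<le> 4 \<Longrightarrow> val (FinSeq (\<rho> @ [(wt q, q)])) = of_bool (q \<noteq> 4)"
    and val_le: "val s \<le> 1"
begin

abbreviation target :: "nat \<Rightarrow> ('x \<times> nat) bform" where
  "target q \<equiv> Atom (wt q, q)"

abbreviation guess :: "('x \<times> nat) bform" where
  "guess \<equiv> Disj (target 2) (target 3)"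

definition guesser :: "(nat, 'x, nat) automaton" where
  "guesser = \<lparr> kind = FiniteWords, alphabet = {0, 1}, states = {..4}, initial = 0,
     delta = (\<lambda>q a. if q = 0 then Conj (target 1) guess
        else if q = 1 \<or> q = a + 2 then target 1 else target 4),
     run_value = val \<rparr>"

text \<open>Only states 0 and 1 remain, and at both of them the atom leading to the accepting sink
  is available.\<close>

definition pruned_guesser :: "(nat, 'x, nat) automaton" where
  "pruned_guesser = guesser \<lparr> states := {0, 1}, delta := (\<lambda>_ _. target 1) \<rparr>"

lemma guesser_simps [simp]:
  "kind guesser = FiniteWords" "alphabet guesser = {0, 1}" "states guesser = {..4}"
  "initial guesser = 0" "run_value guesser = val"
  "kind pruned_guesser = FiniteWords" "alphabet pruned_guesser = {0, 1}"
  "states pruned_guesser = {0, 1}" "initial pruned_guesser = 0" "run_value pruned_guesser = val"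
  by (simp_all add: guesser_def pruned_guesser_def)

section \<open>Every word has value 1\<close>

definition right_guess :: "nat list \<Rightarrow> nat \<Rightarrow> nat \<Rightarrow> bool" where
  "right_guess u i q \<longleftrightarrow> q \<le> 1 \<or> q \<in> {2, 3} \<and> (i < length u \<longrightarrow> q = u ! i + 2)"

text \<open>Eve's invariant: no wrong guess has been made. In \<open>Resolve i \<phi>\<close> the
  current letter is already consumed, so the guess concerns \<open>u ! i\<close>; once the word is
  exhausted either guess is right, since the guessing states accept.\<close>

definition right_positions :: "nat list \<Rightarrow> (nat, 'x, nat) product_pos set" where
  "right_positions u = {Main i q | i q. right_guess u i q} \<union>
     {Resolve i \<phi> | i \<phi>. \<phi> \<in> {Conj (target 1) guess, guess} \<union> {target q | q. right_guess u i q}}"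

text \<open>By staying in \<open>right_positions\<close> Eve keeps state 4 from ever being output,
  so the payoff is the maximal 1.\<close>

lemma has_value_word_game:
  assumes A: "A = guesser \<or> A = pruned_guesser" and u: "set u \<subseteq> {0, 1}"
  shows "has_value (word_game A (FinSeq u)) val 1"
proof -
  let ?G = "word_game A (FinSeq u)"
  let ?I = "right_positions u"
  obtain \<sigma> where \<sigma>: "\<sigma> \<in> strategies Eve ?G"
    and inv: "\<And>p i. p \<in> outcomes Eve ?G \<sigma> \<Longrightarrow> has_idx p i \<Longrightarrow> seq_nth p i \<in> ?I"
  proof (rule invariant_strategy)
    show "start ?G \<in> ?I"
      using A by (auto simp: word_game_def product_def word_arena_def right_positions_def right_guess_def)
    fix x y
    assume x: "x \<in> ?I" and xy: "(x, y) \<in> edges ?G"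
    show "y \<in> ?I" if "owner ?G x \<noteq> Eve"
      using x xy that
      by (auto simp: right_positions_def right_guess_def word_game_def product_def word_arena_def)
    show "\<exists>z\<in>?I. (x, z) \<in> edges ?G" if "owner ?G x = Eve"
    proof (cases "\<exists>i. x = Resolve i guess")
      case True
      then obtain i where i: "x = Resolve i guess"
        by blast
      \<comment> \<open>Eve looks up the next letter of the known word; 2 also serves as the default
        at the end of the word.\<close>
      define q :: nat where "q = (if i < length u \<and> u ! i = 1 then 3 else 2)"
      have "u ! i \<in> {0, 1}" if "i < length u"
        using u nth_mem[OF that] by blast
      then have "Resolve i (target q) \<in> ?I" "(x, Resolve i (target q)) \<in> edges ?G"
        using xy i by (auto simp: q_def right_positions_def right_guess_def word_game_def product_def)
      then show ?thesis
        by blast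
    next
      case False
      \<comment> \<open>Away from \<open>guess\<close> every move of Eve preserves the
        invariant.\<close>
      then have "y \<in> ?I"
        using A x xy that u
        by (auto simp: right_positions_def right_guess_def word_game_def product_def word_arena_def
            guesser_def pruned_guesser_def)
      with xy show ?thesis
        by blast
    qed
  qed (rule that)
  have "val (trace ?G p) = 1" if p: "p \<in> outcomes Eve ?G \<sigma>" for p
  proof -
    have wf: "wf ((edges ?G)\<inverse>)"
      unfolding word_game_def by (intro wf_product wf_word_arena)
    obtain xs where xs: "p = FinSeq xs"
      using finite_play[OF wf outcome_play[OF p]] .
    obtain ls where ls: "trace ?G p = FinSeq ls"
      unfolding xs trace_FinSeq by blast
    show ?thesis
    proof (cases ls rule: rev_exhaust)
      case Nil
      then show ?thesis
        using ls val_empty by simp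
    next
      case (snoc ls' l)
      \<comment> \<open>The last output decides the payoff. It leaves an atom in the invariant, and
        such an atom leads to a state other than 4.\<close>
      then have "l \<in> set ls"
        by simp
      then obtain x y where "x \<in> set xs" and xy: "label ?G (x, y) = Some l"
        using trace_FinSeq_label ls outcome_play[OF p] unfolding xs by metis
      then have "x \<in> ?I"
        using inv[OF p] unfolding xs in_set_conv_nth by force
      moreover obtain i where "x = Resolve i (Atom l)"
        using xy
        by (cases "(x, y)" rule: product_label.cases) (auto simp: word_game_def product_def)
      ultimately obtain q where "l = (wt q, q)" "q \<le> 3"
        by (auto simp: right_positions_def right_guess_def)
      then show ?thesis
        using ls snoc val_snoc by simp
    qed
  qed
  then show ?thesis
    using has_value_maximum[OF \<sigma>, of val 1] val_le by (simp add: one_ereal_def)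
qed

lemma aut_val_word:
  assumes "A = guesser \<or> A = pruned_guesser" and "w \<in> words FiniteWords {0, 1}"
  shows "aut_val A w = 1"
  using assms has_value_word_game
  by (intro aut_val_eq) (auto simp: words_def one_ereal_def)

section \<open>Determinizability by pruning\<close>

lemma alternating_automaton_guesser: "alternating_automaton guesser"
  using has_value_word_game
  by (auto simp: alternating_automaton_def words_def one_ereal_def guesser_def)

lemma alternating_automaton_pruned_guesser: "alternating_automaton pruned_guesser"
  using has_value_word_game
  by (auto simp: alternating_automaton_def words_def one_ereal_def pruned_guesser_def guesser_def)

lemma determinizable_by_pruning_guesser: "determinizable_by_pruning guesser"
  unfolding determinizable_by_pruning_def
proof (intro exI conjI)
  show "alternating_automaton pruned_guesser"
    by (rule alternating_automaton_pruned_guesser)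
  show "deterministic pruned_guesser"
    by (simp add: deterministic_def pruned_guesser_def)
  show "pruned_to guesser pruned_guesser"
    by (auto simp: pruned_to_def pruned_guesser_def guesser_def)
  show "equivalent guesser pruned_guesser"
    by (simp add: equivalent_def aut_val_word)
qed

lemma delta_guesser:
  "delta guesser q a = (if q = 0 then Conj (target 1) guess
     else if q = 1 \<or> q = a + 2 then target 1 else target 4)"
  by (simp add: guesser_def)

lemma delta_subformulas_guesser:
  "delta_subformulas guesser = {Conj (target 1) guess, guess} \<union> target ` {1, 2, 3, 4}"
proof -
  have "{..4} = {0, 1, 2, 3, 4 :: nat}"
    by auto
  then show ?thesis
    by (simp add: delta_subformulas_def guesser_def) auto
qed

subsection \<open>Adam refutes every guess\<close>

fun refuting :: "(nat, 'x, nat) letter_pos \<Rightarrow> bool" where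
  "refuting (PickLetter q) \<longleftrightarrow> q \<noteq> 1"
| "refuting (ResolveLetter a \<phi>) \<longleftrightarrow> \<phi> \<noteq> target 1"

text \<open>As long as Adam avoids the accepting sink, this bounds the number of moves until the
  formula \<open>target 4\<close> is reached: letter, conjunction, disjunction, guess, refuting
  letter.\<close>

fun stage :: "(nat, 'x, nat) letter_pos \<Rightarrow> nat" where
  "stage (PickLetter q) = (if q = 0 then 5 else if q = 4 then 0 else 1)"
| "stage (ResolveLetter a (Conj \<phi> \<psi>)) = 4"
| "stage (ResolveLetter a (Disj \<phi> \<psi>)) = 3"
| "stage (ResolveLetter a (Atom p)) = (if snd p = 4 then 0 else 2)"

text \<open>A winning Eve strategy in her own letter game is played against Adam's refutation. From
  some prefix on the run is in state 4 and pays 0, while the word read so far has value 1.\<close>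

lemma not_history_deterministic_guesser: "\<not> history_deterministic guesser"
proof
  let ?G = "letter_arena Adam guesser"
  assume "history_deterministic guesser"
  then obtain \<sigma> where \<sigma>: "\<sigma> \<in> strategies Eve ?G"
    and win: "\<And>p. p \<in> outcomes Eve ?G \<sigma> \<Longrightarrow> trace ?G p \<in> letter_objective (\<ge>) guesser"
    unfolding history_deterministic_def wins_def by blast
  obtain \<tau> where \<tau>: "\<tau> \<in> strategies Adam ?G"
    and inv: "\<And>p i. p \<in> outcomes Adam ?G \<tau> \<Longrightarrow> has_idx p i \<Longrightarrow> seq_nth p i \<in> Collect refuting"
  proof (rule invariant_strategy)
    show "start ?G \<in> Collect refuting"
      by (simp add: letter_arena_def)
    fix x y
    assume x: "x \<in> Collect refuting" and xy: "(x, y) \<in> edges ?G"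
    show "y \<in> Collect refuting" if "owner ?G x \<noteq> Adam"
      using x xy that
      by (auto simp: letter_arena_def delta_subformulas_guesser)
    show "\<exists>z\<in>Collect refuting. (x, z) \<in> edges ?G" if "owner ?G x = Adam"
    proof (cases x)
      case (PickLetter q)
      \<comment> \<open>State 2 guesses 0 and is refuted by 1; state 3 guesses 1 and is refuted by
        0. In states 0 and 4 the letter is arbitrary.\<close>
      define a :: nat where "a = (if q = 2 then 1 else 0)"
      have "(x, ResolveLetter a (delta guesser q a)) \<in> edges ?G"
        using xy PickLetter by (auto simp: letter_arena_def a_def)
      moreover have "refuting (ResolveLetter a (delta guesser q a))"
        using x PickLetter by (auto simp: guesser_def a_def)
      ultimately show ?thesis
        by blast
    next
      case (ResolveLetter a \<phi>)
      \<comment> \<open>The conjunction is the only formula that Adam resolves; he declines the sink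
        and makes Eve guess.\<close>
      then have "a \<in> {0, 1}" "\<phi> = Conj (target 1) guess"
        using xy that by (auto simp: letter_arena_def delta_subformulas_guesser)
      then have "(x, ResolveLetter a guess) \<in> edges ?G"
        using ResolveLetter by (auto simp: letter_arena_def delta_subformulas_guesser)
      then show ?thesis
        by force
    qed
  qed (rule that)
  obtain p where pE: "p \<in> outcomes Eve ?G \<sigma>" and pA: "p \<in> outcomes Adam ?G \<tau>"
    using joint_outcome[OF \<sigma> \<tau>] .
  obtain \<pi> where \<pi>: "trace ?G p = InfSeq \<pi>"
    and geq: "\<And>i. val (FinSeq (map (\<lambda>j. snd (\<pi> j)) [0..<Suc i]))
        \<ge> aut_val guesser (FinSeq (map (\<lambda>j. fst (\<pi> j)) [0..<Suc i]))"
    using win[OF pE] by (auto simp: letter_objective_def simp del: upt_Suc)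
  define lab where "lab i = label ?G (seq_nth p i, seq_nth p (Suc i))" for i
  define J where "J = {i. has_idx p (Suc i) \<and> lab i \<noteq> None}"
  \<comment> \<open>Eve's objective contains only infinite traces, so \<open>\<pi>\<close> lists
    infinitely many outputs along \<open>J\<close>.\<close>
  have J: "infinite J" "\<pi> = (\<lambda>n. the (lab (enumerate J n)))"
    using \<pi> by (auto simp: trace_def lab_def J_def Let_def split: if_splits)
  have edge: "(seq_nth p i, seq_nth p (Suc i)) \<in> edges ?G" if "has_idx p (Suc i)" for i
    using outcome_play[OF pE] that by (simp add: plays_def)
  have pred: "has_idx p i" if "has_idx p (Suc i)" for i
    using that by (cases p) auto
  have stage_le: "stage (seq_nth p i) \<le> 5 - i" if "has_idx p i" for i
    using that
  proof (induction i)
    case 0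
    then show ?case
      using outcome_play[OF pE] by (simp add: plays_def letter_arena_def)
  next
    case (Suc i)
    \<comment> \<open>With truncated subtraction this also says that stage 0 is never left: state 4
      is absorbing.\<close>
    have "stage y \<le> stage x - 1" if "(x, y) \<in> edges ?G" "refuting x" "refuting y" for x y
      using that by (auto simp: letter_arena_def delta_subformulas_guesser delta_guesser split: if_splits)
    from this[OF edge[OF Suc.prems]] inv[OF pA] pred[OF Suc.prems] Suc
    show ?case
      by fastforce
  qed
  \<comment> \<open>Output \<open>n\<close> occurs at an index at least \<open>n\<close> of the
    play, so the bound on \<open>stage\<close> in terms of play indices carries over to
    outputs.\<close>
  have \<pi>_pos: "\<exists>i\<ge>n. has_idx p i \<and> seq_nth p i = ResolveLetter (fst (\<pi> n)) (Atom (snd (\<pi> n))) \<and>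
      (seq_nth p i, seq_nth p (Suc i)) \<in> edges ?G" for n
  proof (intro exI conjI)
    let ?i = "enumerate J n"
    show "n \<le> ?i"
      using J(1) by (rule le_enumerate)
    have i: "has_idx p (Suc ?i)" "lab ?i = Some (\<pi> n)"
      using enumerate_in_set[OF J(1), of n] by (auto simp: J_def J(2))
    show "has_idx p ?i" "(seq_nth p ?i, seq_nth p (Suc ?i)) \<in> edges ?G"
      using i(1) by (rule pred, rule edge)
    show "seq_nth p ?i = ResolveLetter (fst (\<pi> n)) (Atom (snd (\<pi> n)))"
      using i(2) by (auto simp: lab_def letter_arena_def elim: letter_label.elims)
  qed
  have "fst (\<pi> n) \<in> {0, 1}" for n
    using \<pi>_pos[of n] by (auto simp: letter_arena_def)
  \<comment> \<open>The prefix of six letters ends with output 5, whose position has index at least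
    5 and hence stage 0.\<close>
  then have "FinSeq (map (\<lambda>j. fst (\<pi> j)) [0..<Suc 5]) \<in> words FiniteWords {0, 1}"
    by (simp add: words_def image_subset_iff del: upt_Suc)
  with geq[of 5] have "val (FinSeq (map (\<lambda>j. snd (\<pi> j)) [0..<Suc 5])) \<ge> 1"
    by (simp add: aut_val_word del: upt_Suc)
  moreover have "snd (\<pi> 5) = (wt 4, 4)"
  proof -
    obtain i where i: "i \<ge> 5" "has_idx p i"
      "seq_nth p i = ResolveLetter (fst (\<pi> 5)) (Atom (snd (\<pi> 5)))"
      "(seq_nth p i, seq_nth p (Suc i)) \<in> edges ?G"
      using \<pi>_pos[of 5] by blast
    have "stage (seq_nth p i) = 0"
      using stage_le[OF i(2)] i(1) by simp
    with i(3,4) show ?thesis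
      by (auto simp: letter_arena_def delta_subformulas_guesser split: if_splits)
  qed
  ultimately have "val (FinSeq (map (\<lambda>j. snd (\<pi> j)) [0..<5] @ [(wt 4, 4)])) \<ge> 1"
    by (simp only: upt_Suc le0 if_True map_append list.map)
  then show False
    by (simp add: val_snoc)
qed

text \<open>Adam owns all positions, but the choice between the edges from position 1 comes after Eve's
  guess. The letters are read off the target positions: by truncated subtraction, the edges into
  1, 2 and 3 are labelled 0, 0 and 1.\<close>

definition refuting_arena :: "(nat, nat) arena" where
  "refuting_arena = \<lparr> positions = {..3}, owner = (\<lambda>_. Adam), start = 0,
     edges = {(0, 1), (1, 2), (1, 3)}, label = (\<lambda>(_, v). Some (v - 2)) \<rparr>"

text \<open>Adam's invariant in the product: he takes the conjunct \<open>guess\<close>, then the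
  edge contradicting the guess. The game component is already 1 during the guess, because the first
  letter has been read.\<close>

definition refuting_positions :: "(nat, 'x, nat) product_pos set" where
  "refuting_positions = {Main 0 0, Resolve 1 (Conj (target 1) guess), Resolve 1 guess}
     \<union> {Resolve 1 (target q) | q. q \<in> {2, 3}} \<union> {Main 1 q | q. q \<in> {2, 3}}
     \<union> {Resolve v (target 4) | v. v \<in> {2, 3}} \<union> {Main v 4 | v. v \<in> {2, 3}}"

lemma wf_refuting_arena: "wf ((edges refuting_arena)\<inverse>)"
  by (rule wf_subset[OF wf_measure[of "\<lambda>i. 3 - i"]]) (auto simp: refuting_arena_def)

lemma game_over_refuting_arena: "game_over FiniteWords {0, 1} refuting_arena"
  using wf_refuting_arena
  by (rule game_over_FiniteWords[rotated]) (auto simp: arena_over_def refuting_arena_def)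

text \<open>Used twice: Adam can stay inside the invariant, and a maximal play inside it can end
  only in state 4.\<close>

lemma refuting_positions_successor:
  assumes "x \<in> refuting_positions"
  obtains (rejected) v where "x = Main v 4"
    | (edge) y where "y \<in> refuting_positions" "(x, y) \<in> edges (product refuting_arena guesser)"
proof -
  let ?S = "\<lambda>x y. y \<in> refuting_positions \<and> (x, y) \<in> edges (product refuting_arena guesser)"
  have s1: "?S (Main 0 0) (Resolve 1 (Conj (target 1) guess))"
    by (force simp: refuting_positions_def product_def refuting_arena_def delta_guesser)
  \<comment> \<open>At \<open>guess\<close>, a position of Eve, one successor suffices to exclude a
    dead end.\<close>
  have s2: "?S (Resolve 1 (Conj (target 1) guess)) (Resolve 1 guess)"
    "?S (Resolve 1 guess) (Resolve 1 (target 2))"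
    by (simp_all add: refuting_positions_def product_def refuting_arena_def delta_subformulas_guesser)
  have s3: "?S (Resolve 1 (target q)) (Main 1 q)" if "q \<in> {2, 3}" for q
    using that
    by (auto simp: refuting_positions_def product_def refuting_arena_def delta_subformulas_guesser)
  \<comment> \<open>The guess 0 of state 2 is refuted by the edge into 3, labelled 1; the guess 1 of
    state 3 by the edge into 2, labelled 0.\<close>
  have s4: "?S (Main 1 2) (Resolve 3 (target 4))" "?S (Main 1 3) (Resolve 2 (target 4))"
    by (force simp: refuting_positions_def product_def refuting_arena_def delta_guesser)+
  have s5: "?S (Resolve v (target 4)) (Main v 4)" if "v \<in> {2, 3}" for v
    using that
    by (auto simp: refuting_positions_def product_def refuting_arena_def delta_subformulas_guesser)
  from assms have "x \<in> {Main 0 0, Resolve 1 (Conj (target 1) guess), Resolve 1 guess, Main 1 2, Main 1 3}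
      \<or> (\<exists>q\<in>{2, 3}. x = Resolve 1 (target q)) \<or> (\<exists>v\<in>{2, 3}. x = Resolve v (target 4))
      \<or> (\<exists>v. x = Main v 4)"
    by (auto simp: refuting_positions_def)
  then have "(\<exists>v. x = Main v 4) \<or> (\<exists>y. ?S x y)"
    by (elim disjE insertE emptyE bexE) (use s1 s2 s3 s4 s5 in blast)+
  then show ?thesis
    using edge rejected by blast
qed

text \<open>The game itself has value 1 because all words do, whereas in the product Adam picks the
  second letter after seeing the guess and forces payoff 0.\<close>

lemma not_good_for_games_guesser: "\<not> good_for_games TYPE(nat) guesser"
proof
  let ?P = "product refuting_arena guesser"
  assume gfg: "good_for_games TYPE(nat) guesser"
  obtain \<sigma> where "\<sigma> \<in> strategies Eve refuting_arena"
    by (rule strategies_nonempty)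
  \<comment> \<open>Every play pays 1, so any Eve strategy is optimal.\<close>
  then have "has_value refuting_arena (aut_val guesser) (ereal 1)"
    using game_over_refuting_arena
    by (rule_tac has_value_maximum) (auto simp: game_over_def aut_val_word dest: outcome_play)
  then have "has_value ?P val (ereal 1)"
    using gfg game_over_refuting_arena unfolding good_for_games_def by (metis guesser_simps(1,2,5))
  then have upper: "upper_value ?P val = ereal 1"
    by (simp add: has_value_def)
  obtain \<tau> where \<tau>: "\<tau> \<in> strategies Adam ?P"
    and inv: "\<And>p i. p \<in> outcomes Adam ?P \<tau> \<Longrightarrow> has_idx p i \<Longrightarrow> seq_nth p i \<in> refuting_positions"
  proof (rule invariant_strategy)
    show "start ?P \<in> refuting_positions"
      by (simp add: product_def refuting_arena_def refuting_positions_def)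
    fix x y
    assume x: "x \<in> refuting_positions" and xy: "(x, y) \<in> edges ?P"
    show "y \<in> refuting_positions" if "owner ?P x \<noteq> Adam"
      using x xy that
      by (auto simp: product_def refuting_arena_def refuting_positions_def delta_subformulas_guesser)
    show "\<exists>z\<in>refuting_positions. (x, z) \<in> edges ?P" if "owner ?P x = Adam"
      using x
    proof (cases rule: refuting_positions_successor)
      case (rejected v)
      \<comment> \<open>In the invariant \<open>v\<close> is 2 or 3, which no edge of the arena
        leaves, contrary to the assumed move.\<close>
      with x xy show ?thesis
        by (auto simp: product_def refuting_arena_def refuting_positions_def)
    qed blast
  qed (rule that)
  have "val (trace ?P p) \<le> 0" if p: "p \<in> outcomes Adam ?P \<tau>" for p
  proof -
    have wf: "wf ((edges ?P)\<inverse>)"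
      by (intro wf_product wf_refuting_arena)
    obtain xs where xs: "p = FinSeq xs"
      using finite_play[OF wf outcome_play[OF p]] .
    have I: "x \<in> refuting_positions" if "x \<in> set xs" for x
      using inv[OF p] that unfolding xs in_set_conv_nth by force
    have start: "start ?P = Main 0 0"
      by (simp add: product_def refuting_arena_def)
    have path: "xs \<noteq> []" "xs ! 0 = Main 0 0" "\<And>i. Suc i < length xs \<Longrightarrow> (xs ! i, xs ! Suc i) \<in> edges ?P"
      "\<And>v. (last xs, v) \<notin> edges ?P"
      using outcome_play[OF p] start unfolding xs by (auto simp: plays_def last_conv_nth)
    obtain v where last: "last xs = Main v 4"
      using I[OF last_in_set[OF path(1)]] path(4) by (cases rule: refuting_positions_successor) auto
    \<comment> \<open>The play has at least two positions, as it starts in state 0 and ends in state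
      4.\<close>
    obtain ys x where ys: "xs = ys @ [x, Main v 4]"
    proof (cases "butlast xs" rule: rev_exhaust)
      case Nil
      with path(1,2) last show ?thesis
        by (cases xs) (auto split: if_splits)
    next
      case (snoc ys x)
      with that[of ys x] path(1) last show ?thesis
        by (metis append_butlast_last_id append.assoc append_Cons append_Nil)
    qed
    have "(x, Main v 4) \<in> edges ?P"
      using path(3)[of "length ys"] by (simp add: ys nth_append)
    \<comment> \<open>No edge of the arena is silent, so \<open>Main v 4\<close> is entered only
      from an atom, and the invariant fixes its weight to \<open>wt 4\<close>.\<close>
    with I[of x] have "x = Resolve v (target 4)"
      by (auto simp: ys product_def refuting_arena_def refuting_positions_def)
    then have "label ?P (x, Main v 4) = Some (wt 4, 4)"
      by (simp add: product_def)
    then obtain ls where "trace ?P p = FinSeq (ls @ [(wt 4, 4)])"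
      unfolding xs ys by (rule trace_FinSeq_last)
    then show ?thesis
      by (simp add: val_snoc)
  qed
  then have "upper_value ?P val \<le> ereal 0"
    by (rule upper_value_le[OF \<tau>])
  with upper show False
    by simp
qed

end

section \<open>The Boolean and the quantitative instance\<close>

theorem proposition13:
  shows "(\<exists>(F :: nat set) (A :: (nat, unit, nat) automaton).
            alternating_finite_automaton F A \<and>
            determinizable_by_pruning A \<and>
            \<not> history_deterministic A \<and>
            \<not> good_for_games TYPE(nat) A) \<and>
         (\<exists>(Val :: rat seq \<Rightarrow> real) (A :: (nat, rat, nat) automaton).
            quantitative_automaton Val A \<and>
            determinizable_by_pruning A \<and>
            \<not> history_deterministic A \<and>
            \<not> good_for_games TYPE(nat) A)"
proof
  \<comment> \<open>All states but the rejecting sink accept; the initial one is among them, which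
    gives the empty run payoff 1.\<close>
  interpret letter_guessing "\<lambda>_. ()" "acceptance_value 0 {..<4 :: nat}"
  proof
    show "acceptance_value 0 {..<4 :: nat} \<rho> \<le> 1" for \<rho> :: "(unit \<times> nat) seq"
      by (cases \<rho>) auto
  qed auto
  have "alternating_finite_automaton {..<4} guesser"
    using alternating_automaton_guesser by (auto simp: alternating_finite_automaton_def)
  then show "\<exists>(F :: nat set) (A :: (nat, unit, nat) automaton).
      alternating_finite_automaton F A \<and> determinizable_by_pruning A \<and>
      \<not> history_deterministic A \<and> \<not> good_for_games TYPE(nat) A"
    using determinizable_by_pruning_guesser not_history_deterministic_guesser
      not_good_for_games_guesser by blast
next
  \<comment> \<open>Weight 0 will mark exactly the transitions into the rejecting sink, so the last
    weight plays the part of the last state. The empty sequence gets 1 for \<open>val_empty\<close>,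
    and the default 0 on infinite ones respects \<open>val_le\<close>.\<close>
  define Val :: "rat seq \<Rightarrow> real" where
    "Val s = (case s of FinSeq xs \<Rightarrow> of_bool (xs = [] \<or> last xs \<noteq> 0) | InfSeq f \<Rightarrow> 0)" for s
  interpret letter_guessing "\<lambda>q. of_bool (q \<noteq> 4)" "\<lambda>\<rho>. Val (map_seq fst \<rho>)"
    by standard (auto simp: Val_def split: seq.split)
  have "quantitative_automaton Val guesser"
    using alternating_automaton_guesser by (simp add: quantitative_automaton_def)
  then show "\<exists>(Val :: rat seq \<Rightarrow> real) (A :: (nat, rat, nat) automaton).
      quantitative_automaton Val A \<and> determinizable_by_pruning A \<and>
      \<not> history_deterministic A \<and> \<not> good_for_games TYPE(nat) A"
    using determinizable_by_pruning_guesser not_history_deterministic_guesser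
      not_good_for_games_guesser by blast
qed

end
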